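(* Let $m$ and $n$ be integers with $2 \le m < n$. If $n \ge R_{m-1} - m$, where $R_{m-1}$ is the $(m-1)$-th Ramanujan prime, then the complete bipartite graph $K_{m,n}$ is prime.
   Context: A simple graph with $N$ vertices is called prime if it has a prime labeling, i.e., a bijection from its vertex set to $\{1, 2, \ldots, N\}$ such that the labels of any two adjacent vertices are relatively prime. Let $\pi(x)$ denote the number of primes less than or equal to $x$. For $j \ge 1$, the $j$-th Ramanujan prime $R_j$ is the least integer such that $\pi(x) - \pi\left(\frac{x}{2}\right) \ge j$ holds for all $x \ge R_j$ (for example $R_1 = 2$, $R_2 = 11$, $R_3 = 17$, $R_4 = 29$, $R_5 = 41$). *)

theory Defs
  imports "Graph_Theory.Kuratowski" "HOL-Computational_Algebra.Primes" Complex_Main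
begin

definition prime_labeling :: "('a, 'b) pre_digraph \<Rightarrow> ('a \<Rightarrow> nat) \<Rightarrow> bool" where
  "prime_labeling G f \<longleftrightarrow>
     bij_betw f (verts G) {1..card (verts G)} \<and>
     (\<forall>u\<in>verts G. \<forall>v\<in>verts G. (u, v) \<in> arcs_ends G \<longrightarrow> coprime (f u) (f v))"

text \<open>
  Finite simple graphs are represented as finite, loop-free, symmetric digraphs without
  parallel arcs (locale \<open>graph\<close>); an undirected edge is a pair of opposite arcs.
\<close>
definition prime_graph :: "('a, 'b) pre_digraph \<Rightarrow> bool" where
  "prime_graph G \<longleftrightarrow> graph G \<and> (\<exists>f. prime_labeling G f)"

definition prime_count :: "real \<Rightarrow> nat" where
  "prime_count x = card {p::nat. prime p \<and> real p \<le> x}"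

text \<open>
  Only indices \<open>j \<ge> 1\<close> are meaningful: for \<open>j = 0\<close> every integer qualifies and there is no
  least one. For \<open>j \<ge> 1\<close> the least integer cannot be \<open>\<le> 0\<close>, since the condition fails at
  \<open>x = 0\<close>.
\<close>
definition ramanujan_prime :: "nat \<Rightarrow> int" where
  "ramanujan_prime j =
     (LEAST R::int. \<forall>x::real. x \<ge> of_int R \<longrightarrow>
        int (prime_count x) - int (prime_count (x / 2)) \<ge> int j)"

text \<open>
  Being a complete bipartite graph with parts of sizes \<open>m\<close> and \<open>n\<close> is a predicate on graphs;
  such graphs exist for all \<open>m\<close> and \<open>n\<close>.
\<close>
lemma complete_bipartite_digraph_exists:
  "\<exists>G :: (nat, nat \<times> nat) pre_digraph. complete_bipartite_digraph m n G"
proof -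
  define U V where "U = {..<m}" and "V = {m..<m + n}"
  define G where "G = \<lparr>pverts = U \<union> V, parcs = U \<times> V \<union> V \<times> U\<rparr>"
  have "U \<inter> V = {}" "card U = m" "card V = n" "finite (pverts G)"
    by (auto simp: U_def V_def G_def)
  then have "complete_bipartite_digraph m n (with_proj G)"
    unfolding complete_bipartite_digraph_pair_def by (auto simp: G_def)
  then show ?thesis ..
qed

end

theory Submission
  imports Defs "HOL-Real_Asymp.Real_Asymp"
begin

text \<open>
  Put \<open>N = m + n\<close>. A prime \<open>p > N / 2\<close> is coprime to every other number in \<open>{1..N}\<close>, because its
  second multiple already exceeds \<open>N\<close>. So if there are \<open>m - 1\<close> primes in \<open>(N / 2, N]\<close>, label the part
  of size \<open>m\<close> by \<open>1\<close> and these primes, and the other part by whatever remains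
  (\<open>prime_graph_complete_bipartite\<close>). The number of such primes is \<open>\<pi>(N) - \<pi>(N / 2)\<close>, and
  \<open>N \<ge> R\<^bsub>m - 1\<^esub>\<close> bounds it from below by \<open>m - 1\<close>, directly by the defining property of the
  Ramanujan prime.

  The substance lies in that last step: the least threshold \<open>R\<^sub>j\<close> has its defining property only if
  some threshold exists, that is, if \<open>\<pi>(x) - \<pi>(x / 2)\<close> tends to infinity. This asymptotic
  strengthening of Bertrand's postulate is proved by Erdos's method. Factor
  \<open>C = 2n choose n\<close>, which is at least \<open>4\<^sup>n / 2n\<close>. Every prime power dividing \<open>C\<close> is at most \<open>2n\<close>, so the primes \<open>p \<le> sqrt (2n)\<close>
  contribute at most \<open>2n\<close> each and all larger ones occur at most once. No prime \<open>p > 2\<close> in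
  \<open>(2n/3, n]\<close> divides \<open>C\<close>, and the primes up to \<open>2n/3\<close> have product at most \<open>4\<close> to the power
  \<open>2n/3\<close>. What is left, \<open>4\<close> to the power \<open>n/3\<close> up to a factor of size \<open>2n\<close> to the power
  \<open>1 + sqrt (2n)\<close>, must come from the primes in \<open>(n, 2n]\<close>; as each of them contributes at most
  \<open>2n\<close>, their number grows without bound.
\<close>

section \<open>Prime powers dividing binomial coefficients\<close>

text \<open>
  The fractions \<open>1 / (k * (n choose k))\<close> form Leibniz's harmonic triangle: the entry at \<open>(n, k + 1)\<close>
  is the entry at \<open>(n - 1, k)\<close> minus the one at \<open>(n, k)\<close>. Hence the entry at \<open>(n, k)\<close> is an integer
  combination of \<open>1 / i\<close> for \<open>i \<in> {n - k + 1..n}\<close>, and multiplying it by a common multiple of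
  these \<open>i\<close> gives an integer.
\<close>
lemma times_binomial_dvd_common_multiple:
  fixes n k L :: nat
  assumes "0 < k" "k \<le> n" "\<And>i. i \<in> {n - k + 1..n} \<Longrightarrow> i dvd L"
  shows "k * (n choose k) dvd L"
  using assms
proof (induction k arbitrary: n rule: nat_induct_non_zero)
  case 1
  then show ?case by simp
next
  case (Suc k n)
  have "k * (n choose k) dvd L" and "k * ((n - 1) choose k) dvd L"
    using Suc.prems by (auto intro!: Suc.IH)
  \<comment> \<open>\<open>a\<close> and \<open>b\<close> are \<open>L\<close> times the two neighbouring entries; \<open>a - b\<close> is \<open>L\<close> times the new one.\<close>
  then obtain a b where a: "L = k * ((n - 1) choose k) * a" and b: "L = k * (n choose k) * b"
    by (elim dvdE)
  have pascal: "n * ((n - 1) choose k) = (n - k) * (n choose k)"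
    by (metis binomial_absorb_comp)
  have next_entry: "(n - k) * (n choose k) = Suc k * (n choose Suc k)"
    using binomial_absorb_comp binomial_absorption by metis
  have "k * ((n - k) * (n choose k) * a) = n * L"
    using pascal a by (metis mult.assoc mult.left_commute)
  moreover have "k * ((n - k) * (n choose k) * b) = (n - k) * L"
    using b by simp
  moreover have "n * L = (n - k) * L + k * L"
    using Suc.prems by (simp flip: add_mult_distrib)
  ultimately have "k * ((n - k) * (n choose k) * a) = k * ((n - k) * (n choose k) * b + L)"
    by (metis add_mult_distrib2)
  then have "(n - k) * (n choose k) * a = (n - k) * (n choose k) * b + L"
    using Suc.hyps by (metis mult_cancel1 not_gr0)
  then have "(n - k) * (n choose k) dvd L"
    by (metis dvd_add_right_iff dvd_triv_left)
  then show ?case by (simp only: next_entry)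
qed

lemma prime_power_dvd_Lcm:
  fixes A :: "nat set"
  assumes "prime p" "finite A" "0 \<notin> A" "A \<noteq> {}" "p ^ a dvd Lcm A"
  shows "\<exists>x\<in>A. p ^ a dvd x"
  using assms(2,4,3,5)
proof (induction A rule: finite_ne_induct)
  case (singleton x)
  then show ?case by simp
next
  case (insert x A)
  have nz: "x \<noteq> 0" "Lcm A \<noteq> 0"
    using insert.prems insert.hyps by (auto simp: Lcm_0_iff)
  have "multiplicity p (lcm x (Lcm A)) = max (multiplicity p x) (multiplicity p (Lcm A))"
    using \<open>prime p\<close> prime_factorization_lcm[OF nz]
    by (simp flip: count_prime_factorization_prime)
  moreover have "a \<le> multiplicity p (lcm x (Lcm A))"
    using insert.prems nz \<open>prime p\<close> by (intro multiplicity_geI) (auto simp: lcm_eq_0_iff)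
  ultimately have "p ^ a dvd x \<or> p ^ a dvd Lcm A"
    by (auto simp: max_def intro: multiplicity_dvd' split: if_splits)
  then show ?case using insert by auto
qed

text \<open>
  A prime power that divides a least common multiple divides one of the numbers, and here these
  numbers are at most \<open>n\<close>. This replaces the usual computation with Legendre's formula for the
  exponent of \<open>p\<close> in a factorial.
\<close>
lemma prime_power_dvd_binomial_le:
  fixes p n k a :: nat
  assumes "prime p" "0 < k" "k \<le> n" "p ^ a dvd (n choose k)"
  shows "p ^ a \<le> n"
proof -
  have "k * (n choose k) dvd Lcm {n - k + 1..n}"
    using assms by (intro times_binomial_dvd_common_multiple) auto
  then have "p ^ a dvd Lcm {n - k + 1..n}"
    using assms(4) by (meson dvd_mult dvd_trans)
  then obtain x where "x \<in> {n - k + 1..n}" "p ^ a dvd x"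
    using prime_power_dvd_Lcm[of p "{n - k + 1..n}" a] assms by (force simp: Suc_diff_le)
  then show ?thesis
    using dvd_imp_le[of "p ^ a" x] by auto
qed

section \<open>The product of the primes up to a bound\<close>

lemma prod_primes_dvd:
  fixes A :: "nat set"
  assumes "finite A" "\<And>p. p \<in> A \<Longrightarrow> prime p" "\<And>p. p \<in> A \<Longrightarrow> p dvd N"
  shows "\<Prod>A dvd N"
  using assms
proof (induction A rule: finite_induct)
  case (insert p A)
  then have "coprime p (\<Prod>A)"
    by (intro prod_coprime_right) (metis insertCI primes_coprime)
  with insert show ?case by (auto intro: divides_mult)
qed auto

definition primorial :: "nat \<Rightarrow> nat" where
  "primorial n = \<Prod>{p. prime p \<and> p \<le> n}"

text \<open>
  An even \<open>n > 2\<close> is not prime, so it can be replaced by \<open>n - 1\<close>. For \<open>n = 2m + 1\<close> the primes in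
  \<open>(m + 1, n]\<close> all divide \<open>n choose m\<close>. This coefficient is at most \<open>4\<^sup>m\<close>, since it occurs twice in
  a row with sum \<open>2 * 4\<^sup>m\<close>; the primes up to \<open>m + 1\<close> are left to the induction hypothesis.
\<close>
lemma primorial_le_four_power: "primorial n \<le> 4 ^ n"
proof (induction n rule: less_induct)
  case (less n)
  consider "n \<le> 2" | "n > 2" "even n" | m where "n = 2 * m + 1" "m > 0"
    by (metis add_0 mult_0_right not_gr0 not_le oddE one_le_numeral)
  then show ?case
  proof cases
    case 1
    have "{p::nat. prime p \<and> p \<le> n} = (if n = 2 then {2} else {})"
      using 1 by (auto dest: prime_ge_2_nat)
    then show ?thesis by (simp add: primorial_def)
  next
    case 2
    then have "\<not> prime n"
      using prime_odd_nat by blast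
    then have "p \<le> n \<longleftrightarrow> p \<le> n - 1" if "prime p" for p
      using that by (cases "p = n") auto
    then have "{p. prime p \<and> p \<le> n} = {p. prime p \<and> p \<le> n - 1}"
      by auto
    then have "primorial n = primorial (n - 1)"
      by (simp add: primorial_def)
    also have "\<dots> \<le> 4 ^ (n - 1)"
      using 2 by (intro less) auto
    also have "\<dots> \<le> 4 ^ n"
      by (intro power_increasing) auto
    finally show ?thesis .
  next
    case 3
    let ?lower = "{p. prime p \<and> p \<le> m + 1}" and ?upper = "{p. prime p \<and> m + 1 < p \<and> p \<le> n}"
    let ?C = "(2 * m + 1) choose m"
    have C_pos: "?C > 0" by simp
    have "p dvd ?C" if p: "p \<in> ?upper" for p
    proof -
      have "p dvd fact (2 * m + 1)"
        using p 3 by (simp add: prime_dvd_fact_iff del: fact_Suc)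
      also have "fact (2 * m + 1) = fact m * fact (m + 1) * ?C"
        using binomial_fact_lemma[of m "2 * m + 1"] by (simp add: mult_2)
      finally show ?thesis
        using p by (auto simp: prime_dvd_mult_iff prime_dvd_fact_iff simp del: fact_Suc)
    qed
    then have "\<Prod>?upper dvd ?C"
      by (intro prod_primes_dvd) auto
    then have upper: "\<Prod>?upper \<le> ?C"
      using C_pos by (rule dvd_imp_le)
    have "2 * ?C = ?C + ((2 * m + 1) choose (m + 1))"
      using binomial_symmetric[of m "2 * m + 1"] by (simp add: mult_2)
    also have "\<dots> = (\<Sum>k\<in>{m, m + 1}. (2 * m + 1) choose k)"
      by simp
    also have "\<dots> \<le> (\<Sum>k\<le>2 * m + 1. (2 * m + 1) choose k)"
      by (intro sum_mono2) auto
    also have "\<dots> = 2 * 4 ^ m"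
      using choose_row_sum[of "2 * m + 1"] by (simp add: power_mult del: sum.atMost_Suc)
    finally have C: "?C \<le> 4 ^ m" by simp
    have "{p. prime p \<and> p \<le> n} = ?lower \<union> ?upper"
      using 3 by auto
    then have "primorial n = primorial (m + 1) * \<Prod>?upper"
      unfolding primorial_def by (subst prod.union_disjoint [symmetric]) auto
    also have "\<dots> \<le> 4 ^ (m + 1) * 4 ^ m"
      using 3 upper C by (intro mult_mono less) auto
    also have "\<dots> = 4 ^ n"
      using 3 by (simp add: power_add mult_2)
    finally show ?thesis .
  qed
qed

section \<open>Primes in the upper half of an interval\<close>

lemma multiplicity_le_one:
  fixes p i :: nat
  assumes "prime p" "0 < i" "i < p\<^sup>2"
  shows "multiplicity p i \<le> 1"
  by (metis assms Suc_1 less_Suc_eq_le multiplicity_lessI nat_dvd_not_less not_prime_unit less_irrefl)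

text \<open>
  The only multiples of \<open>p\<close> up to \<open>2n\<close> are \<open>p\<close> and \<open>2p\<close>, so \<open>p\<close> has exponent \<open>2\<close> in \<open>(2n)!\<close>. Both
  factors are used up by the denominator \<open>n! * n!\<close>.
\<close>
lemma prime_not_dvd_central_binomial:
  fixes p n :: nat
  assumes "prime p" "2 < p" "p \<le> n" "2 * n < 3 * p"
  shows "\<not> p dvd (2 * n choose n)"
proof
  assume dvd: "p dvd (2 * n choose n)"
  have fact_split: "(fact (2 * n) :: nat) = fact n * fact n * (2 * n choose n)"
    using binomial_fact_lemma[of n "2 * n"] by (simp add: mult_2)
  have "p dvd fact n"
    using assms by (simp add: prime_dvd_fact_iff)
  then have "p * p * p dvd fact (2 * n)"
    unfolding fact_split using dvd by (intro mult_dvd_mono)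
  then have "3 \<le> multiplicity p (fact (2 * n) :: nat)"
    using assms(1) by (intro multiplicity_geI) (auto simp: power3_eq_cube)
  also have "\<dots> = (\<Sum>i\<in>{1..2 * n}. multiplicity p i)"
    using assms(1) unfolding fact_prod
    by (simp add: prime_elem_multiplicity_prod_distrib)
  also have "\<dots> \<le> (\<Sum>i\<in>{1..2 * n}. if i \<in> {p, 2 * p} then 1 else 0)"
  proof (intro sum_mono)
    fix i assume i: "i \<in> {1..2 * n}"
    show "multiplicity p i \<le> (if i \<in> {p, 2 * p} then 1 else 0)"
    proof (cases "p dvd i")
      case True
      then obtain c where c: "i = p * c" ..
      have "c \<noteq> 0"
        using c i by auto
      have "p * c < p * 3"
        using c i assms(4) by (simp only: atLeastAtMost_iff mult.commute[of 3 p]) linarith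
      then have "c < 3" by (simp only: mult_less_cancel1)
      with \<open>c \<noteq> 0\<close> have "c \<in> {1, 2}" by auto
      moreover have "3 * p \<le> p\<^sup>2"
        unfolding power2_eq_square using assms(2) by (intro mult_le_mono1) simp
      then have "i < p\<^sup>2"
        using i assms(4) by (simp only: atLeastAtMost_iff) linarith
      ultimately show ?thesis
        using multiplicity_le_one[of p i] assms(1) i c by auto
    qed (simp add: not_dvd_imp_multiplicity_0)
  qed
  also have "\<dots> = card ({1..2 * n} \<inter> {p, 2 * p})"
    by (simp add: sum.If_cases del: insert_iff Int_insert_right)
  also have "\<dots> \<le> card {p, 2 * p}"
    by (intro card_mono) auto
  also have "\<dots> \<le> 2"
    by (simp add: card_insert_if)
  finally show False by simp
qed

text \<open>
  The right-hand side splits the primes by the way in which they enter the estimate: small and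
  very large ones by the trivial bound \<open>2n\<close>, those between \<open>sqrt (2n)\<close> and \<open>2n/3\<close> by the factor \<open>p\<close>
  of the primorial, and the remaining ones up to \<open>n\<close> not at all. A small prime gets both factors; the loss is
  harmless and lets the product over all primes separate into two.
\<close>
lemma prime_power_dvd_central_binomial_le:
  fixes p n a :: nat
  assumes "prime p" "0 < n" and a: "p ^ a dvd (2 * n choose n)"
  shows "p ^ a \<le> (if p\<^sup>2 \<le> 2 * n \<or> n < p then 2 * n else 1) *
                 (if p \<le> 2 * n div 3 then p else 1)"
proof (cases "p\<^sup>2 \<le> 2 * n \<or> n < p")
  case True
  have "p ^ a \<le> 2 * n"
    using prime_power_dvd_binomial_le[of p n "2 * n" a] assms by auto
  with True show ?thesis
    using prime_gt_0_nat[OF assms(1)] by (cases p) (auto intro: trans_le_add1)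
next
  case False
  have "p ^ a \<le> 2 * n"
    using prime_power_dvd_binomial_le[of p n "2 * n" a] assms by auto
  also have "2 * n < p\<^sup>2"
    using False by simp
  finally have "a < 2"
    using assms(1) prime_gt_1_nat power_less_imp_less_exp by blast
  then consider "a = 0" | "a = 1"
    by linarith
  then show ?thesis
  proof cases
    case 2
    \<comment> \<open>\<open>p = 2\<close> with \<open>p\<^sup>2 > 2 n\<close> would force \<open>n = 1 < p\<close>.\<close>
    have "p \<noteq> 2"
      using False by auto
    then have "2 < p"
      using prime_ge_2_nat[OF assms(1)] by simp
    then have "3 * p \<le> 2 * n"
      using prime_not_dvd_central_binomial[of p n] assms 2 False
      by (metis linorder_not_less power_one_right)
    then show ?thesis
      using 2 False by auto
  qed (use assms prime_gt_0_nat[OF assms(1)] in \<open>auto simp: Suc_le_eq\<close>)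
qed

lemma central_binomial_le:
  fixes n :: nat
  assumes "0 < n"
  shows "(2 * n choose n) \<le>
    (2 * n) ^ (card {p. prime p \<and> p\<^sup>2 \<le> 2 * n} + card {p. prime p \<and> n < p \<and> p \<le> 2 * n}) *
    4 ^ (2 * n div 3)"
proof -
  let ?C = "2 * n choose n" and ?P = "{p. prime p \<and> p \<le> 2 * n}"
  let ?small = "{p. prime p \<and> p\<^sup>2 \<le> 2 * n}" and ?large = "{p. prime p \<and> n < p \<and> p \<le> 2 * n}"
  let ?third = "{p. prime p \<and> p \<le> 2 * n div 3}"
  let ?g = "\<lambda>p. if p\<^sup>2 \<le> 2 * n \<or> n < p then 2 * n else 1"
  let ?h = "\<lambda>p. if p \<le> 2 * n div 3 then p else 1"
  have self_le_square: "p \<le> p\<^sup>2" for p :: nat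
    by (cases p) (auto simp: power2_eq_square)
  have factors: "prime_factors ?C \<subseteq> ?P"
    using prime_power_dvd_binomial_le[of _ n "2 * n" 1] assms
    by (auto simp: in_prime_factors_iff)
  have "?C = (\<Prod>p\<in>prime_factors ?C. p ^ multiplicity p ?C)"
    by (simp add: prod_prime_factors)
  also have "\<dots> \<le> (\<Prod>p\<in>prime_factors ?C. ?g p * ?h p)"
    using assms by (intro prod_mono conjI prime_power_dvd_central_binomial_le)
      (auto simp: in_prime_factors_iff multiplicity_dvd)
  also have "\<dots> \<le> (\<Prod>p\<in>?P. ?g p * ?h p)"
    using factors assms
    by (intro dvd_imp_le prod_dvd_prod_subset prod_pos) (auto simp: prime_gt_0_nat)
  also have "\<dots> = (\<Prod>p\<in>?P. ?g p) * (\<Prod>p\<in>?P. ?h p)"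
    by (rule prod.distrib)
  also have "(\<Prod>p\<in>?P. ?g p) = (2 * n) ^ card (?P \<inter> {p. p\<^sup>2 \<le> 2 * n \<or> n < p})"
    by (simp add: prod.If_cases)
  also have "?P \<inter> {p. p\<^sup>2 \<le> 2 * n \<or> n < p} = ?small \<union> ?large"
    using self_le_square by (auto intro: order_trans)
  also have "(2 * n) ^ card (?small \<union> ?large) \<le> (2 * n) ^ (card ?small + card ?large)"
    using assms by (intro power_increasing card_Un_le) auto
  also have "(\<Prod>p\<in>?P. ?h p) = \<Prod>(?P \<inter> {p. p \<le> 2 * n div 3})"
    by (simp add: prod.If_cases)
  also have "?P \<inter> {p. p \<le> 2 * n div 3} = ?third"
    by auto
  also have "\<Prod>?third \<le> 4 ^ (2 * n div 3)"
    using primorial_le_four_power[of "2 * n div 3"] by (simp add: primorial_def)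
  finally show ?thesis
    by simp
qed

text \<open>
  The logarithm of the bound for \<open>2n choose n\<close> above, set against \<open>4\<^sup>n / 2n \<le> (2n choose n)\<close>, with
  \<open>sqrt (2n)\<close> as a bound for the number of small primes and \<open>1\<close> accounting for the denominator \<open>2n\<close>.
\<close>
lemma card_primes_between_lower_bound:
  fixes n :: nat
  assumes "0 < n"
  shows "real n / 3 * ln 4 \<le>
    (1 + sqrt (2 * real n) + real (card {p. prime p \<and> n < p \<and> p \<le> 2 * n})) * ln (2 * real n)"
proof -
  let ?s = "card {p. prime p \<and> p\<^sup>2 \<le> 2 * n}" and ?l = "card {p. prime p \<and> n < p \<and> p \<le> 2 * n}"
  have "{p. prime p \<and> p\<^sup>2 \<le> 2 * n} \<subseteq> {1..nat \<lfloor>sqrt (2 * real n)\<rfloor>}"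
  proof safe
    fix p :: nat assume "prime p" "p\<^sup>2 \<le> 2 * n"
    then have "(real p)\<^sup>2 \<le> 2 * real n"
      by (metis of_nat_le_iff of_nat_mult of_nat_numeral of_nat_power)
    then have "real p \<le> sqrt (2 * real n)"
      by (rule real_le_rsqrt)
    then show "p \<in> {1..nat \<lfloor>sqrt (2 * real n)\<rfloor>}"
      using \<open>prime p\<close> by (simp add: Suc_le_eq prime_gt_0_nat le_nat_floor)
  qed
  then have "?s \<le> card {1..nat \<lfloor>sqrt (2 * real n)\<rfloor>}"
    by (intro card_mono) auto
  then have "real ?s \<le> real (nat \<lfloor>sqrt (2 * real n)\<rfloor>)"
    by (simp only: of_nat_le_iff card_atLeastAtMost)
  also have "real (nat \<lfloor>sqrt (2 * real n)\<rfloor>) \<le> sqrt (2 * real n)"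
    by simp
  finally have s: "real ?s \<le> sqrt (2 * real n)"
    by simp
  have "3 * (2 * n div 3) \<le> 2 * n"
    by simp
  then have third: "real (2 * n div 3) \<le> 2 * real n / 3"
    by linarith
  have "4 ^ n \<le> 2 * real n * real (2 * n choose n)"
    using central_binomial_lower_bound[OF assms] assms by (simp add: field_simps)
  also have "\<dots> \<le> 2 * real n * real ((2 * n) ^ (?s + ?l) * 4 ^ (2 * n div 3))"
    using central_binomial_le[OF assms] by (intro mult_left_mono iffD2[OF of_nat_le_iff]) simp_all
  finally have "(4::real) ^ n \<le> (2 * real n) ^ (1 + ?s + ?l) * 4 ^ (2 * n div 3)"
    by (simp add: power_add mult_ac)
  then have "ln (4 ^ n :: real) \<le> ln ((2 * real n) ^ (1 + ?s + ?l) * 4 ^ (2 * n div 3))"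
    using assms by (subst ln_le_cancel_iff) auto
  then have "real n * ln 4 \<le> real (1 + ?s + ?l) * ln (2 * real n) + real (2 * n div 3) * ln 4"
    using assms by (simp only: ln_mult_pos ln_realpow zero_less_power zero_less_mult_iff
        of_nat_0_less_iff zero_less_numeral simp_thms)
  also have "\<dots> \<le> (1 + sqrt (2 * real n) + real ?l) * ln (2 * real n) + 2 * real n / 3 * ln 4"
    using s third assms by (intro add_mono mult_right_mono) auto
  finally show ?thesis
    by (simp add: algebra_simps)
qed

lemma eventually_many_primes_between:
  "\<forall>\<^sub>F n in sequentially. j \<le> card {p::nat. prime p \<and> n < p \<and> p \<le> 2 * n}"
proof -
  have "\<forall>\<^sub>F x in at_top. (1 + sqrt (2 * x) + real j) * ln (2 * x) < x / 3 * ln 4"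
    by real_asymp
  then have "\<forall>\<^sub>F n in sequentially.
      (1 + sqrt (2 * real n) + real j) * ln (2 * real n) < real n / 3 * ln 4"
    by (rule eventually_compose_filterlim) (rule filterlim_real_sequentially)
  then show ?thesis
    using eventually_gt_at_top[of 0]
  proof eventually_elim
    case (elim n)
    let ?l = "card {p::nat. prime p \<and> n < p \<and> p \<le> 2 * n}"
    have "(1 + sqrt (2 * real n) + real j) * ln (2 * real n) <
        (1 + sqrt (2 * real n) + real ?l) * ln (2 * real n)"
      using elim card_primes_between_lower_bound[of n] by linarith
    moreover have "0 \<le> ln (2 * real n)"
      using elim by simp
    ultimately have "real j < real ?l"
      by (simp add: mult_less_cancel_right)
    then show ?case by simp
  qed
qed

section \<open>Ramanujan primes\<close>

lemma prime_count_diff: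
  assumes "y \<le> x"
  shows "int (prime_count x) - int (prime_count y) =
    int (card {p::nat. prime p \<and> y < real p \<and> real p \<le> x})"
proof -
  have fin: "finite {p::nat. prime p \<and> real p \<le> z}" for z
    by (rule finite_subset[of _ "{..nat \<lfloor>z\<rfloor>}"]) (auto simp: le_nat_floor)
  have "{p::nat. prime p \<and> real p \<le> x} =
      {p. prime p \<and> real p \<le> y} \<union> {p. prime p \<and> y < real p \<and> real p \<le> x}"
    using assms by auto
  moreover have "finite {p::nat. prime p \<and> y < real p \<and> real p \<le> x}"
    by (rule finite_subset[OF _ fin[of x]]) auto
  ultimately have "prime_count x =
      prime_count y + card {p::nat. prime p \<and> y < real p \<and> real p \<le> x}"
    unfolding prime_count_def using fin by (subst card_Un_disjoint [symmetric]) auto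
  then show ?thesis by simp
qed

text \<open>
  Every integer in \<open>(n, 2n]\<close> with \<open>n = \<lfloor>x / 2\<rfloor>\<close> lies in \<open>(x / 2, x]\<close>, which reduces real \<open>x\<close> to the
  case of integers.
\<close>
lemma ramanujan_threshold_exists:
  "\<exists>R::int. \<forall>x::real. x \<ge> of_int R \<longrightarrow>
     int (prime_count x) - int (prime_count (x / 2)) \<ge> int j"
proof -
  obtain N where N: "\<And>n. n \<ge> N \<Longrightarrow> j \<le> card {p::nat. prime p \<and> n < p \<and> p \<le> 2 * n}"
    using eventually_many_primes_between[of j] by (auto simp: eventually_at_top_linorder)
  have "int j \<le> int (prime_count x) - int (prime_count (x / 2))"
    if x: "x \<ge> of_int (2 * int N)" for x :: real
  proof -
    define n where "n = nat \<lfloor>x / 2\<rfloor>"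
    have n: "N \<le> n" "real n \<le> x / 2" "x / 2 < real n + 1"
      using x unfolding n_def by (auto simp: le_nat_floor) linarith
    have fin: "finite {p::nat. prime p \<and> x / 2 < real p \<and> real p \<le> x}"
      by (rule finite_subset[of _ "{..nat \<lfloor>x\<rfloor>}"]) (auto simp: le_nat_floor)
    have "j \<le> card {p::nat. prime p \<and> n < p \<and> p \<le> 2 * n}"
      using n(1) by (rule N)
    also have "\<dots> \<le> card {p::nat. prime p \<and> x / 2 < real p \<and> real p \<le> x}"
      using n fin by (intro card_mono) auto
    finally show ?thesis
      using x by (subst prime_count_diff) auto
  qed
  then show ?thesis by blast
qed

text \<open>
  The integers are not well-ordered, so besides the existence of a threshold the attainment of
  the least one needs a lower bound: at \<open>x = 0\<close> the inequality fails for \<open>j > 0\<close>, which makes every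
  threshold positive and reduces the matter to a minimum over the natural numbers.
\<close>
lemma ramanujan_prime_le:
  assumes "0 < j" "of_int (ramanujan_prime j) \<le> x"
  shows "int j \<le> int (prime_count x) - int (prime_count (x / 2))"
proof -
  define Q where "Q R \<longleftrightarrow> (\<forall>x::real. x \<ge> of_int R \<longrightarrow>
     int (prime_count x) - int (prime_count (x / 2)) \<ge> int j)" for R :: int
  have pos: "0 < R" if "Q R" for R
  proof (rule ccontr)
    assume "\<not> 0 < R"
    then have "int (prime_count 0) - int (prime_count (0 / 2)) \<ge> int j"
      using that unfolding Q_def by (metis of_int_le_0_iff linorder_not_less)
    then show False using assms(1) by simp
  qed
  obtain R where "Q R"
    using ramanujan_threshold_exists[of j] unfolding Q_def by blast
  then have "Q (int (nat R))"
    using pos by (simp add: less_imp_le)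
  define r where "r = (LEAST k. Q (int k))"
  have "Q (int r)"
    unfolding r_def using \<open>Q (int (nat R))\<close> by (rule LeastI)
  moreover have "int r \<le> R'" if "Q R'" for R'
    using that pos[OF that] Least_le[of "\<lambda>k. Q (int k)" "nat R'"] by (simp add: r_def nat_le_iff)
  ultimately have "(LEAST R. Q R) = int r"
    by (rule Least_equality)
  then have "ramanujan_prime j = int r"
    by (simp add: ramanujan_prime_def Q_def)
  then show ?thesis
    using \<open>Q (int r)\<close> assms(2) by (simp add: Q_def)
qed

section \<open>Labeling complete bipartite graphs\<close>

lemma prime_graph_complete_bipartite:
  fixes G :: "('a, 'b) pre_digraph"
  assumes G: "complete_bipartite_digraph m n G" and "0 < m"
    and S: "S \<subseteq> {p. prime p \<and> m + n < 2 * p \<and> p \<le> m + n}" "card S = m - 1"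
  shows "prime_graph G"
proof -
  obtain U V where UV: "verts G = U \<union> V" "U \<inter> V = {}" "card U = m" "card V = n"
    "arcs_ends G = U \<times> V \<union> V \<times> U" and "graph G"
    using G unfolding complete_bipartite_digraph_def by blast
  interpret graph G by fact
  have fin: "finite U" "finite V"
    using finite_verts UV(1) by (metis finite_Un)+
  have card_verts: "card (verts G) = m + n"
    using UV fin by (simp add: card_Un_disjoint)
  have "finite S"
    by (rule finite_subset[of _ "{..m + n}"]) (use S in auto)
  have "1 \<notin> S"
    using S by auto
  define A where "A = insert 1 S"
  define B where "B = {1..m + n} - A"
  have A: "A \<subseteq> {1..m + n}" "card A = m"
    using S \<open>finite S\<close> \<open>1 \<notin> S\<close> \<open>0 < m\<close> by (auto simp: A_def Suc_le_eq prime_gt_0_nat)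
  then have B: "card B = n"
    unfolding B_def by (subst card_Diff_subset) (auto intro: finite_subset)
  have coprime_AB: "coprime a b" if "a \<in> A" "b \<in> B" for a b
  proof (cases "a = 1")
    case False
    then have a: "prime a" "m + n < 2 * a" "a \<in> S"
      using that S by (auto simp: A_def)
    have "\<not> a dvd b"
    proof
      assume "a dvd b"
      then obtain c where c: "b = a * c" ..
      have "b \<noteq> a" "b \<noteq> 0" "b \<le> m + n"
        using that by (auto simp: B_def)
      then have "2 \<le> c"
        using c by (cases c; cases "c - 1") auto
      then have "2 * a \<le> b"
        using c by simp
      with a \<open>b \<le> m + n\<close> show False by simp
    qed
    then show ?thesis
      using a prime_imp_coprime by blast
  qed simp
  obtain f where f: "bij_betw f U A"
    using finite_same_card_bij[of U A] fin UV A by (auto intro: finite_subset)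
  obtain g where g: "bij_betw g V B"
    using finite_same_card_bij[of V B] fin UV B by (auto simp: B_def)
  define h where "h v = (if v \<in> U then f v else g v)" for v
  have "bij_betw h U A"
    using f by (rule bij_betw_cong[THEN iffD1, rotated]) (simp add: h_def)
  moreover have "bij_betw h V B"
    using g by (rule bij_betw_cong[THEN iffD1, rotated]) (use UV(2) in \<open>auto simp: h_def\<close>)
  ultimately have h: "bij_betw h (U \<union> V) (A \<union> B)" "h ` U = A" "h ` V = B"
    by (auto simp: B_def bij_betw_def intro!: bij_betw_combine[unfolded bij_betw_def, of h U A V B, THEN conjunct1])
  have "A \<union> B = {1..card (verts G)}"
    using A card_verts by (auto simp: B_def)
  with h have "bij_betw h (verts G) {1..card (verts G)}"
    by (simp add: UV(1))
  moreover have "coprime (h u) (h v)" if "(u, v) \<in> arcs_ends G" for u v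
    using that coprime_AB[of "h u" "h v"] coprime_AB[of "h v" "h u"] h(2,3)
    unfolding UV(5) by (auto simp: coprime_commute)
  ultimately have "prime_labeling G h"
    by (auto simp: prime_labeling_def)
  with \<open>graph G\<close> show ?thesis
    by (auto simp: prime_graph_def)
qed

theorem theorem18:
  fixes m n :: nat and G :: "('a, 'b) pre_digraph"
  assumes "2 \<le> m" and "m < n"
    and "int n \<ge> ramanujan_prime (m - 1) - int m"
    and "complete_bipartite_digraph m n G"
  shows "prime_graph G"
proof -
  let ?x = "real (m + n)"
  have "ramanujan_prime (m - 1) \<le> int (m + n)"
    using assms(3) by simp
  then have "real_of_int (ramanujan_prime (m - 1)) \<le> ?x"
    by (metis of_int_le_iff of_int_of_nat_eq)
  then have "int (m - 1) \<le> int (prime_count ?x) - int (prime_count (?x / 2))"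
    using assms(1) by (intro ramanujan_prime_le) auto
  also have "\<dots> = int (card {p::nat. prime p \<and> ?x / 2 < real p \<and> real p \<le> ?x})"
    by (rule prime_count_diff) simp
  also have "{p::nat. prime p \<and> ?x / 2 < real p \<and> real p \<le> ?x} =
      {p. prime p \<and> m + n < 2 * p \<and> p \<le> m + n}"
    by (auto simp: field_simps simp flip: of_nat_add)
  finally have "m - 1 \<le> card {p. prime p \<and> m + n < 2 * p \<and> p \<le> m + n}"
    by simp
  then obtain S where "S \<subseteq> {p. prime p \<and> m + n < 2 * p \<and> p \<le> m + n}" "card S = m - 1"
    by (rule obtain_subset_with_card_n)
  then show ?thesis
    using assms by (intro prime_graph_complete_bipartite[of m n G S]) auto
qed

end
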